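(* Let $A$ be a complex-valued continuous function on $[0,\infty)$, and for $\lambda\in\mathbb{C}$ let $X(r,\lambda)$ be the $2\times2$ matrix solution of $$X'(r,\lambda)=\begin{bmatrix} i\lambda & -\overline{A(r)}\\ -A(r)&0\end{bmatrix}X(r,\lambda),\qquad X(0,\lambda)=I .$$ Fix $r>0$. For $n\in\mathbb{N}$ put $h=r/n$, $t_j=jh$, and $$a^{(h)}_0=hA(t_1),\ a^{(h)}_1=hA(t_2),\ \ldots,\ a^{(h)}_{n-1}=hA(t_n),\qquad a_j^{(h)}=0\ \ (j\ge n),$$ where $h$ is so small that all these numbers are less than one in absolute value. Let $$M(0,k,z)=W(a^{(h)}_k)Z(z)\,W(a^{(h)}_{k-1})Z(z)\cdots W(a^{(h)}_0)Z(z),\qquad Z(z)=\begin{bmatrix}z&0\\0&1\end{bmatrix},\quad W(a)=\begin{bmatrix}1&-\bar a\\-a&1\end{bmatrix}.$$ Then $$X(r,\lambda)=\lim_{h\to0}M(0,n,\exp(i\lambda h)),$$ and the convergence is uniform for $\lambda$ in compact subsets of $\mathbb{C}$.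
   Context: The limit $h\to0$ means $n\to\infty$ with $h=r/n$ and $r$ fixed; $'$ denotes $d/dr$. *)

theory Defs
  imports "HOL-Analysis.Analysis"
begin

definition W :: "complex \<Rightarrow> complex^2^2" where
  "W a = vector [vector [1, - cnj a], vector [- a, 1]]"

definition Z :: "complex \<Rightarrow> complex^2^2" where
  "Z z = vector [vector [z, 0], vector [0, 1]]"

text \<open>\<open>M a k z\<close> is the ordered product \<open>M(0,k,z) = W(a\<^sub>k) Z(z) \<cdots> W(a\<^sub>0) Z(z)\<close>;
  it has \<open>k + 1\<close> pairs of factors.\<close>

primrec M :: "(nat \<Rightarrow> complex) \<Rightarrow> nat \<Rightarrow> complex \<Rightarrow> complex^2^2" where
  "M a 0 z = W (a 0) ** Z z"
| "M a (Suc k) z = (W (a (Suc k)) ** Z z) ** M a k z"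

text \<open>\<open>coeff_h A r n j\<close> is \<open>a\<^sub>j\<^sup>(\<^sup>h\<^sup>)\<close> for \<open>h = r / n\<close>. The junk value at \<open>n = 0\<close> is
  irrelevant for the limit \<open>n \<rightarrow> \<infinity>\<close>.\<close>

definition coeff_h :: "(real \<Rightarrow> complex) \<Rightarrow> real \<Rightarrow> nat \<Rightarrow> nat \<Rightarrow> complex" where
  "coeff_h A r n j =
     (let h = r / real n in
      if j < n then complex_of_real h * A (real (j + 1) * h) else 0)"

definition system_matrix :: "(real \<Rightarrow> complex) \<Rightarrow> real \<Rightarrow> complex \<Rightarrow> complex^2^2" where
  "system_matrix A r l = vector [vector [\<i> * l, - cnj (A r)], vector [- A r, 0]]"

text \<open>\<open>X r l\<close> solves the system on the half-line, with a one-sided derivative at \<open>0\<close>.\<close>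

definition is_matrix_solution ::
  "(real \<Rightarrow> complex) \<Rightarrow> (real \<Rightarrow> complex \<Rightarrow> complex^2^2) \<Rightarrow> bool" where
  "is_matrix_solution A X \<longleftrightarrow>
     (\<forall>l. X 0 l = mat 1 \<and>
       (\<forall>r\<ge>0. ((\<lambda>t. X t l) has_vector_derivative (system_matrix A r l ** X r l))
                (at r within {0..})))"

text \<open>The requirement that \<open>h\<close> be so small that all coefficients are less than one in absolute
  value holds for all large \<open>n\<close>, so it does not restrict the limit \<open>n \<rightarrow> \<infinity>\<close>.\<close>

lemma eventually_coeff_h_less_one:
  assumes A: "continuous_on {0..} A" and r: "r > 0"
  shows "\<forall>\<^sub>F n in sequentially. \<forall>j. cmod (coeff_h A r n j) < 1"
proof -
  have "continuous_on {0..r} A"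
    using A by (rule continuous_on_subset) auto
  then have "bounded (A ` {0..r})"
    by (intro compact_imp_bounded compact_continuous_image) auto
  then obtain B where B: "B > 0" "\<And>x. x \<in> {0..r} \<Longrightarrow> cmod (A x) \<le> B"
    by (auto simp: bounded_pos)
  obtain N :: nat where N: "real N > r * B"
    using reals_Archimedean2 by blast
  show ?thesis
    unfolding eventually_sequentially
  proof (intro exI allI impI)
    fix n j :: nat
    assume "N \<le> n"
    then have n: "real n > r * B" using N by linarith
    moreover have "r * B > 0" using r B by simp
    ultimately have n0: "real n > 0" by linarith
    show "cmod (coeff_h A r n j) < 1"
    proof (cases "j < n")
      case True
      then have "real (j + 1) \<le> real n" by simp
      then have "real (j + 1) * r \<le> real n * r" using r by (intro mult_right_mono) auto
      then have "real (j + 1) * (r / real n) \<in> {0..r}"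
        using r n0 by (auto simp: field_simps)
      then have "cmod (A (real (j + 1) * (r / real n))) \<le> B" by (rule B(2))
      then have "cmod (coeff_h A r n j) \<le> (r / real n) * B"
        using True r n0 unfolding coeff_h_def Let_def
        by (simp only: if_True norm_mult norm_of_real) (intro mult_mono, auto)
      also have "\<dots> < 1" using n n0 by (simp add: field_simps)
      finally show ?thesis .
    qed (simp add: coeff_h_def)
  qed
qed

end

theory Submission
  imports Defs
begin

text \<open>The product is a one-step method for the differential equation with step \<open>h\<close>: the factor
  \<open>W(a\<^sub>j) Z(exp(i\<lambda>h))\<close> differs from the Euler factor \<open>I + h F((j+1)h)\<close>, where \<open>F\<close> is the
  coefficient matrix of the system, only by \<open>O(h\<^sup>2)\<close>.  The solution satisfies the Euler recursion up
  to a local error \<open>h O(h + \<omega>(h))\<close>, where \<open>\<omega>\<close> is the modulus of continuity of \<open>A\<close> on \<open>[0,r]\<close>, and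
  the discrete Gronwall inequality sums the local errors to \<open>O(h + \<omega>(h))\<close>.  Since \<open>\<lambda>\<close> enters only
  through a bound on \<open>|\<lambda>|\<close>, the estimate is uniform on compact sets.\<close>

section \<open>Matrix norms\<close>

lemma norm_vec_power2: "(norm (x :: 'a::real_normed_vector ^ 'n))\<^sup>2 = (\<Sum>i\<in>UNIV. (norm (x $ i))\<^sup>2)"
  by (simp add: norm_vec_def L2_set_def sum_nonneg)

text \<open>The norm on nested vectors is the Frobenius norm. Cauchy-Schwarz bounds the square of
  entry (i,j) by the squared length of row i of \<open>P\<close> times that of column j of
  \<open>Q\<close>, and the double sum over i and j of these products factors.\<close>

lemma norm_matrix_mult_le:
  fixes P :: "'a::{real_normed_algebra,semiring_1} ^ 'k ^ 'm" and Q :: "'a ^ 'n ^ 'k"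
  shows "norm (P ** Q) \<le> norm P * norm Q"
proof (rule power2_le_imp_le)
  have entry: "(norm ((P ** Q) $ i $ j))\<^sup>2
      \<le> (\<Sum>k\<in>UNIV. (norm (P $ i $ k))\<^sup>2) * (\<Sum>k\<in>UNIV. (norm (Q $ k $ j))\<^sup>2)" for i j
  proof -
    have "norm ((P ** Q) $ i $ j) \<le> (\<Sum>k\<in>UNIV. norm (P $ i $ k * Q $ k $ j))"
      by (simp add: matrix_matrix_mult_def norm_sum)
    also have "\<dots> \<le> (\<Sum>k\<in>UNIV. norm (P $ i $ k) * norm (Q $ k $ j))"
      by (intro sum_mono norm_mult_ineq)
    also have "\<dots> = (\<Sum>k\<in>UNIV. \<bar>norm (P $ i $ k)\<bar> * \<bar>norm (Q $ k $ j)\<bar>)"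
      by simp
    also have "\<dots> \<le> L2_set (\<lambda>k. norm (P $ i $ k)) UNIV * L2_set (\<lambda>k. norm (Q $ k $ j)) UNIV"
      by (rule L2_set_mult_ineq)
    finally have "(norm ((P ** Q) $ i $ j))\<^sup>2
        \<le> (L2_set (\<lambda>k. norm (P $ i $ k)) UNIV * L2_set (\<lambda>k. norm (Q $ k $ j)) UNIV)\<^sup>2"
      by (intro power_mono) auto
    then show ?thesis
      by (simp add: power_mult_distrib L2_set_def sum_nonneg)
  qed
  have "(norm (P ** Q))\<^sup>2 = (\<Sum>i\<in>UNIV. \<Sum>j\<in>UNIV. (norm ((P ** Q) $ i $ j))\<^sup>2)"
    by (simp only: norm_vec_power2)
  also have "\<dots> \<le> (\<Sum>i\<in>UNIV. \<Sum>j\<in>UNIV.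
      (\<Sum>k\<in>UNIV. (norm (P $ i $ k))\<^sup>2) * (\<Sum>k\<in>UNIV. (norm (Q $ k $ j))\<^sup>2))"
    by (intro sum_mono entry)
  also have "\<dots> = (\<Sum>i\<in>UNIV. \<Sum>k\<in>UNIV. (norm (P $ i $ k))\<^sup>2)
      * (\<Sum>j\<in>UNIV. \<Sum>k\<in>UNIV. (norm (Q $ k $ j))\<^sup>2)"
    by (simp only: sum_product)
  \<comment> \<open>The second factor runs through \<open>Q\<close> by columns, whereas its norm is
    defined by rows.\<close>
  also have "(\<Sum>j\<in>UNIV. \<Sum>k\<in>UNIV. (norm (Q $ k $ j))\<^sup>2)
      = (\<Sum>k\<in>UNIV. \<Sum>j\<in>UNIV. (norm (Q $ k $ j))\<^sup>2)"
    by (rule sum.swap)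
  also have "(\<Sum>i\<in>UNIV. \<Sum>k\<in>UNIV. (norm (P $ i $ k))\<^sup>2)
      * (\<Sum>k\<in>UNIV. \<Sum>j\<in>UNIV. (norm (Q $ k $ j))\<^sup>2) = (norm P * norm Q)\<^sup>2"
    by (simp only: norm_vec_power2 power_mult_distrib)
  finally show "(norm (P ** Q))\<^sup>2 \<le> (norm P * norm Q)\<^sup>2" .
qed simp

lemma norm_vector2_le: "norm (vector [a, b] :: 'a::real_normed_vector ^ 2) \<le> norm a + norm b"
proof -
  have "norm (vector [a, b] :: 'a ^ 2) \<le> (\<Sum>i\<in>UNIV. norm ((vector [a, b] :: 'a ^ 2) $ i))"
    unfolding norm_vec_def by (rule L2_set_le_sum) simp
  then show ?thesis
    by (simp add: UNIV_2)
qed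

lemma norm_matrix2_le:
  "norm (vector [vector [a, b], vector [c, d]] :: 'a::real_normed_vector ^ 2 ^ 2)
     \<le> norm a + norm b + norm c + norm d"
  using norm_vector2_le[of "vector [a, b] :: 'a ^ 2" "vector [c, d]"]
    norm_vector2_le[of a b] norm_vector2_le[of c d] by linarith

section \<open>Linearity of the matrix product\<close>

lemma matrix_add_rdistrib:
  fixes P Q :: "'a::semiring_1 ^ 'k ^ 'm"
  shows "(P + Q) ** R = P ** R + Q ** R"
  by (vector matrix_matrix_mult_def sum.distrib distrib_right)

lemma matrix_diff_rdistrib:
  fixes P Q :: "'a::ring_1 ^ 'k ^ 'm"
  shows "(P - Q) ** R = P ** R - Q ** R"
  by (vector matrix_matrix_mult_def sum_subtractf left_diff_distrib)

lemma matrix_diff_ldistrib: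
  fixes P :: "'a::ring_1 ^ 'k ^ 'm"
  shows "P ** (Q - R) = P ** Q - P ** R"
  by (vector matrix_matrix_mult_def sum_subtractf right_diff_distrib)

lemma scaleR_matrix_mult_left:
  fixes P :: "'a::real_algebra_1 ^ 'k ^ 'm"
  shows "(c *\<^sub>R P) ** Q = c *\<^sub>R (P ** Q)"
  by (simp add: vec_eq_iff matrix_matrix_mult_def scaleR_sum_right)

section \<open>Growth and error estimates\<close>

text \<open>Mean value inequality for \<open>f t - t *\<^sub>R v\<close>, whose derivative is
  \<open>f' t - v\<close>. With \<open>v = 0\<close> it yields a Lipschitz bound for the solution,
  with \<open>v\<close> an Euler slope the local error of one step.\<close>

lemma vector_derivative_increment_bound:
  fixes f :: "real \<Rightarrow> 'a::real_normed_vector"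
  assumes f: "\<And>t. t \<in> {a..b} \<Longrightarrow> (f has_vector_derivative f' t) (at t within {a..b})"
    and B: "\<And>t. t \<in> {a..b} \<Longrightarrow> norm (f' t - v) \<le> B"
    and ab: "a \<le> b"
  shows "norm (f b - f a - (b - a) *\<^sub>R v) \<le> (b - a) * B"
proof -
  have "norm ((f b - b *\<^sub>R v) - (f a - a *\<^sub>R v)) \<le> B * norm (b - a)"
  proof (rule differentiable_bound[where S = "{a..b}"
      and f' = "\<lambda>t x. x *\<^sub>R (f' t - v)"])
    fix t assume t: "t \<in> {a..b}"
    have "((\<lambda>t. f t - t *\<^sub>R v) has_vector_derivative f' t - 1 *\<^sub>R v) (at t within {a..b})"
      by (intro derivative_intros f t) (auto intro!: derivative_eq_intros)
    then show "((\<lambda>t. f t - t *\<^sub>R v) has_derivative (\<lambda>x. x *\<^sub>R (f' t - v))) (at t within {a..b})"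
      by (simp add: has_vector_derivative_def)
    show "onorm (\<lambda>x. x *\<^sub>R (f' t - v)) \<le> B"
      using B[OF t] by (simp add: onorm_scaleR_left onorm_id bounded_linear_ident)
  qed (use ab in auto)
  moreover have "(f b - b *\<^sub>R v) - (f a - a *\<^sub>R v) = f b - f a - (b - a) *\<^sub>R v"
    by (simp add: algebra_simps)
  ultimately show ?thesis
    using ab by (simp add: mult.commute)
qed

text \<open>Gronwall by an integrating factor: by Cauchy-Schwarz, \<open>exp (- 2 * L * t)\<close>
  times the squared norm of \<open>f t\<close> is nonincreasing. The square is taken because the
  norm itself need not be differentiable where \<open>f\<close> vanishes.\<close>

lemma linear_growth_bound:
  fixes f :: "real \<Rightarrow> 'a::real_inner"
  assumes f: "\<And>t. t \<in> {0..r} \<Longrightarrow> (f has_vector_derivative f' t) (at t within {0..r})"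
    and L: "\<And>t. t \<in> {0..r} \<Longrightarrow> norm (f' t) \<le> L * norm (f t)"
    and r: "0 \<le> r"
  shows "norm (f r) \<le> exp (L * r) * norm (f 0)"
proof -
  define g where "g t = (f t \<bullet> f t) * exp (- 2 * L * t)" for t
  define g' where "g' t = 2 * (f t \<bullet> f' t - L * (f t \<bullet> f t)) * exp (- 2 * L * t)" for t
  have der: "(g has_real_derivative g' t) (at t within {0..r})" if t: "t \<in> {0..r}" for t
  proof -
    have "((\<lambda>t. f t \<bullet> f t) has_real_derivative 2 * (f t \<bullet> f' t)) (at t within {0..r})"
      using has_derivative_inner[OF f[OF t, unfolded has_vector_derivative_def]
          f[OF t, unfolded has_vector_derivative_def]]
      by (rule has_derivative_imp_has_field_derivative) (simp add: inner_commute)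
    then have "(g has_real_derivative
        (f t \<bullet> f t) * (exp (- 2 * L * t) * (- 2 * L)) + 2 * (f t \<bullet> f' t) * exp (- 2 * L * t))
        (at t within {0..r})"
      unfolding g_def by (auto intro!: derivative_eq_intros)
    then show ?thesis
      by (simp add: g'_def algebra_simps)
  qed
  have nonpos: "g' t \<le> 0" if t: "t \<in> {0..r}" for t
  proof -
    have "f t \<bullet> f' t \<le> norm (f t) * norm (f' t)"
      by (rule norm_cauchy_schwarz)
    also have "\<dots> \<le> norm (f t) * (L * norm (f t))"
      by (intro mult_left_mono L t) simp
    also have "\<dots> = L * (f t \<bullet> f t)"
      by (simp add: dot_square_norm power2_eq_square)
    finally show ?thesis
      by (simp add: g'_def mult_le_0_iff)
  qed
  have "g r \<le> g 0"
  \<comment> \<open>At the endpoints only one-sided derivatives are known, so the criterion with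
    interior derivatives and continuity on the closed interval is the fitting one.\<close>
  proof (rule DERIV_nonpos_imp_decreasing_open[OF r])
    fix t assume t: "0 < t" "t < r"
    then have "at t within {0..r} = at t"
      by (intro at_within_interior) (simp add: interior_atLeastAtMost_real)
    then show "\<exists>y. DERIV g t :> y \<and> y \<le> 0"
      using der[of t] nonpos[of t] t by auto
  next
    show "continuous_on {0..r} g"
      using DERIV_continuous[OF der] by (simp add: continuous_on_eq_continuous_within)
  qed
  moreover have "g r = (norm (f r) / exp (L * r))\<^sup>2"
  proof -
    have "exp (- 2 * L * r) = inverse ((exp (L * r))\<^sup>2)"
      by (simp add: power2_eq_square flip: exp_add exp_minus)
    then show ?thesis
      by (simp only: g_def dot_square_norm power_divide divide_inverse[of "(norm (f r))\<^sup>2"])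
  qed
  moreover have "g 0 = (norm (f 0))\<^sup>2"
    by (simp add: g_def dot_square_norm)
  ultimately have "(norm (f r) / exp (L * r))\<^sup>2 \<le> (norm (f 0))\<^sup>2"
    by simp
  then have "norm (f r) / exp (L * r) \<le> norm (f 0)"
    by (rule power2_le_imp_le) simp
  then show ?thesis
    by (simp add: field_simps)
qed

text \<open>Each of the \<open>n\<close> contributions \<open>b\<close> is amplified at most
  \<open>n\<close> times by \<open>1 + a\<close>, and \<open>1 + a \<le> exp a\<close>. Bounding the
  geometric sum this crudely avoids dividing by \<open>a\<close>. In the application
  \<open>real n * a\<close> does not depend on \<open>n\<close>.\<close>

lemma discrete_gronwall:
  fixes u :: "nat \<Rightarrow> real"
  assumes u0: "u 0 \<le> 0"
    and step: "\<And>j. j < n \<Longrightarrow> u (Suc j) \<le> (1 + a) * u j + b"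
    and a: "0 \<le> a" and b: "0 \<le> b"
  shows "u n \<le> real n * b * exp (real n * a)"
proof -
  have "u j \<le> real j * b * (1 + a) ^ j" if "j \<le> n" for j
    using that
  proof (induction j)
    case 0
    then show ?case using u0 by simp
  next
    case (Suc j)
    have IH: "(1 + a) * u j \<le> (1 + a) * (real j * b * (1 + a) ^ j)"
      using Suc a by (intro mult_left_mono) auto
    have one: "b \<le> b * (1 + a) ^ Suc j"
      using mult_left_mono[OF one_le_power[of "1 + a" "Suc j"] b] a by simp
    have "u (Suc j) \<le> (1 + a) * u j + b"
      using Suc.prems by (intro step) simp
    also have "\<dots> \<le> (1 + a) * (real j * b * (1 + a) ^ j) + b * (1 + a) ^ Suc j"
      using IH one by (rule add_mono)
    also have "\<dots> = real (Suc j) * b * (1 + a) ^ Suc j"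
      by (simp add: algebra_simps)
    finally show ?case .
  qed
  then have "u n \<le> real n * b * (1 + a) ^ n"
    by simp
  also have "\<dots> \<le> real n * b * exp a ^ n"
    using a b by (intro mult_left_mono power_mono) (auto simp: exp_ge_add_one_self)
  finally show ?thesis
    by (simp add: exp_of_nat_mult)
qed

lemma norm_exp_minus_1_le:
  fixes w :: complex
  shows "norm (exp w - 1) \<le> exp (norm w) * norm w"
  using Taylor_exp_field[of w 0] by simp

lemma norm_exp_minus_1_minus_le:
  fixes w :: complex
  shows "norm (exp w - 1 - w) \<le> exp (norm w) * (norm w)\<^sup>2"
  using Taylor_exp_field[of w 1] by (simp add: power2_eq_square algebra_simps)

section \<open>The product as a one-step method\<close>

lemma norm_system_matrix_le: "norm (system_matrix A t l) \<le> norm l + 2 * norm (A t)"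
  unfolding system_matrix_def
  by (rule order_trans[OF norm_matrix2_le]) (simp add: norm_mult)

text \<open>The entry \<open>\<i> * l\<close> cancels, so the oscillation of the coefficient matrix
  is that of \<open>A\<close>, whatever the value of \<open>l\<close>.\<close>

lemma norm_system_matrix_diff_le:
  "norm (system_matrix A s l - system_matrix A t l) \<le> 2 * norm (A s - A t)"
proof -
  have "system_matrix A s l - system_matrix A t l
      = vector [vector [0, - cnj (A s - A t)], vector [- (A s - A t), 0]]"
    by (simp add: system_matrix_def vec_eq_iff forall_2)
  also have "norm \<dots> \<le> 2 * norm (A s - A t)"
    by (rule order_trans[OF norm_matrix2_le]) (simp only: norm_minus_cancel complex_mod_cnj norm_zero)
  finally show ?thesis .
qed

lemma norm_Z_minus_1_le: "norm (Z z - mat 1) \<le> norm (z - 1)"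
proof -
  have "Z z - mat 1 = vector [vector [z - 1, 0], vector [0, 0]]"
    by (simp add: Z_def mat_def vec_eq_iff forall_2)
  then show ?thesis
    using norm_matrix2_le[of "z - 1" 0 0 0] by simp
qed

text \<open>The second column of the step agrees exactly with that of the Euler factor. In the first
  column the defects are \<open>exp w - 1 - w\<close>, a second-order Taylor remainder, and
  \<open>- (of_real h * A t * (exp w - 1))\<close>, a product of two terms of order
  \<open>h\<close>.\<close>

lemma norm_step_minus_euler_le:
  fixes h :: real and l :: complex
  defines "w \<equiv> \<i> * l * of_real h"
  assumes h: "0 \<le> h" and l: "norm l \<le> R" and B: "norm (A t) \<le> B"
  shows "norm (W (of_real h * A t) ** Z (exp w) - mat 1 - h *\<^sub>R system_matrix A t l)
      \<le> h\<^sup>2 * (exp (R * h) * R * (R + B))"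
proof -
  have R: "0 \<le> R" and B0: "0 \<le> B"
    using l B norm_ge_zero order_trans by blast+
  have w: "norm w \<le> R * h"
    using h l by (simp add: w_def norm_mult mult_right_mono)
  have 1: "norm (exp w - 1) \<le> exp (R * h) * (R * h)"
    by (rule order_trans[OF norm_exp_minus_1_le]) (intro mult_mono, use w in auto)
  have 2: "norm (exp w - 1 - w) \<le> exp (R * h) * (R * h)\<^sup>2"
    by (rule order_trans[OF norm_exp_minus_1_minus_le]) (intro mult_mono power_mono, use w in auto)
  have "W (of_real h * A t) ** Z (exp w) - mat 1 - h *\<^sub>R system_matrix A t l
      = vector [vector [exp w - 1 - w, 0], vector [- (of_real h * A t * (exp w - 1)), 0]]"
    by (simp add: W_def Z_def system_matrix_def mat_def matrix_matrix_mult_def sum_2 vec_eq_iff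
        forall_2 w_def scaleR_conv_of_real[where 'a = complex] algebra_simps)
  also have "norm \<dots> \<le> norm (exp w - 1 - w) + h * norm (A t) * norm (exp w - 1)"
    by (rule order_trans[OF norm_matrix2_le]) (use h in \<open>simp add: norm_mult\<close>)
  also have "\<dots> \<le> exp (R * h) * (R * h)\<^sup>2 + h * B * (exp (R * h) * (R * h))"
    using h B B0 by (intro add_mono mult_mono 1 2) auto
  also have "\<dots> = h\<^sup>2 * (exp (R * h) * R * (R + B))"
    by (simp add: power2_eq_square algebra_simps)
  finally show ?thesis .
qed

text \<open>\<open>C\<close> is obtained before \<open>n\<close>, \<open>l\<close> and
  \<open>\<omega>\<close>, which is what makes the convergence uniform for
  \<open>norm l \<le> R\<close>. Here \<open>\<omega>\<close> is any bound for the oscillation of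
  \<open>A\<close> over distances up to the step size.\<close>

lemma product_error_bound:
  fixes A :: "real \<Rightarrow> complex" and r R B :: real
  assumes X: "is_matrix_solution A X" and r: "r > 0" and R: "0 \<le> R" and B: "0 \<le> B"
    and AB: "\<And>t. t \<in> {0..r} \<Longrightarrow> norm (A t) \<le> B"
  obtains C where "0 \<le> C" "\<And>n l \<omega>. 0 < n \<Longrightarrow> norm l \<le> R \<Longrightarrow> 0 \<le> \<omega> \<Longrightarrow>
      (\<And>s t. s \<in> {0..r} \<Longrightarrow> t \<in> {0..r} \<Longrightarrow> \<bar>s - t\<bar> \<le> r / real n \<Longrightarrow> norm (A s - A t) \<le> \<omega>) \<Longrightarrow>
      norm (M (coeff_h A r n) n (exp (\<i> * l * complex_of_real (r / real n))) - X r l)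
        \<le> C * (r / real n + \<omega>)"
proof -
  \<comment> \<open>\<open>L\<close> bounds the coefficient matrix and \<open>S\<close> the solution
    on \<open>{0..r}\<close>; \<open>Q\<close> is the factor of the squared step size in the defect
    from Euler; \<open>D\<close> collects the local errors; \<open>G\<close> is the Gronwall factor;
    \<open>C\<close> also pays for the surplus last factor of the product.\<close>
  define L where "L = R + 2 * B"
  define S where "S = exp (L * r) * norm (mat 1 :: complex^2^2)"
  define Q where "Q = exp (R * r) * R * (R + B)"
  define D where "D = Q * S + 2 * S + L * L * S"
  define G where "G = r * exp (r * (L + Q * r))"
  define C where "C = G * D + exp (R * r) * R * (S + r * (G * D))"
  have L0: "0 \<le> L" and S0: "0 \<le> S" and Q0: "0 \<le> Q"
    using R B by (auto simp: L_def S_def Q_def)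
  then have D0: "0 \<le> D" and G0: "0 \<le> G"
    using r by (auto simp: D_def G_def)
  then have C0: "0 \<le> C"
    using S0 R r by (auto simp: C_def)
  have bound: "norm (M (coeff_h A r n) n (exp (\<i> * l * complex_of_real (r / real n))) - X r l)
        \<le> C * (r / real n + \<omega>)"
    if n: "0 < n" and l: "norm l \<le> R" and om: "0 \<le> \<omega>"
      and mod: "\<And>s t. s \<in> {0..r} \<Longrightarrow> t \<in> {0..r} \<Longrightarrow> \<bar>s - t\<bar> \<le> r / real n \<Longrightarrow> norm (A s - A t) \<le> \<omega>"
    for n l \<omega>
  proof -
    define h where "h = r / real n"
    define z where "z = exp (\<i> * l * complex_of_real h)"
    define F where "F t = system_matrix A t l" for t
    define T where "T j = W (coeff_h A r n j) ** Z z" for j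
    \<comment> \<open>\<open>P j\<close> is the product of the first \<open>j\<close> pairs, so that
      it starts at the identity like the solution; it lags one index behind \<open>M\<close>, whose
      value at \<open>j\<close> has \<open>j + 1\<close> pairs.\<close>
    define P where "P = rec_nat (mat 1) (\<lambda>j. (**) (T j))"
    define Y where "Y j = X (real j * h) l" for j
    have h0: "0 < h" and hr: "h \<le> r" and nh: "real n * h = r"
      using r n by (auto simp: h_def field_simps)
    have P0: "P 0 = mat 1" and PSuc: "P (Suc j) = T j ** P j" for j
      by (simp_all add: P_def)
    have MP: "M (coeff_h A r n) j z = P (Suc j)" for j
      by (induction j) (simp_all add: P0 PSuc T_def)
    have F: "norm (F t) \<le> L" if "t \<in> {0..r}" for t
      using norm_system_matrix_le[of A t l] AB[OF that] l by (simp add: F_def L_def)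
    have X0: "X 0 l = mat 1"
      using X by (simp add: is_matrix_solution_def)
    have X': "((\<lambda>t. X t l) has_vector_derivative F t ** X t l) (at t within T)"
      if "t \<ge> 0" "T \<subseteq> {0..}" for t T
      using X that unfolding is_matrix_solution_def F_def
      by (blast intro: has_vector_derivative_within_subset)
    have FX: "norm (F t ** X t l) \<le> L * norm (X t l)" if "t \<in> {0..r}" for t
      by (rule order_trans[OF norm_matrix_mult_le]) (simp add: mult_right_mono F[OF that])
    have XS: "norm (X t l) \<le> S" if t: "t \<in> {0..r}" for t
    proof -
      have "norm (X t l) \<le> exp (L * t) * norm (X 0 l)"
        by (rule linear_growth_bound[where f' = "\<lambda>t. F t ** X t l"])
          (use t in \<open>auto intro!: X' FX\<close>)
      also have "\<dots> \<le> exp (L * r) * norm (X 0 l)"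
        using t L0 by (intro mult_right_mono) (auto intro: mult_left_mono)
      finally show ?thesis
        by (simp add: S_def X0)
    qed
    have XLip: "norm (X t l - X s l) \<le> L * S * (t - s)" if st: "0 \<le> s" "s \<le> t" "t \<le> r" for s t
    proof -
      have "norm (X t l - X s l - (t - s) *\<^sub>R 0) \<le> (t - s) * (L * S)"
      proof (rule vector_derivative_increment_bound[where f' = "\<lambda>t. F t ** X t l"])
        fix x assume x: "x \<in> {s..t}"
        then have x': "x \<in> {0..r}" using st by auto
        show "norm (F x ** X x l - 0) \<le> L * S"
          using FX[OF x'] mult_left_mono[OF XS[OF x'] L0] by simp
      qed (use st in \<open>auto intro!: X'\<close>)
      then show ?thesis
        by (simp add: mult.commute)
    qed
    \<comment> \<open>Local error of one step: first the defect from Euler applied to the exact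
      solution, then the deviation of the exact increment from the Euler increment.\<close>
    define \<delta> where "\<delta> = h * (Q * S * h) + h * (2 * \<omega> * S + L * (L * S * h))"
    have step: "norm (P (Suc j) - Y (Suc j)) \<le> (1 + h * (L + Q * r)) * norm (P j - Y j) + \<delta>"
      if j: "j < n" for j
    proof -
      \<comment> \<open>The solution is advanced from the left endpoint \<open>s\<close>, but
        coefficient number \<open>j\<close> samples \<open>A\<close> at the right endpoint
        \<open>t\<close>.\<close>
      define s where "s = real j * h"
      define t where "t = real (Suc j) * h"
      have ts: "t - s = h"
        by (simp add: s_def t_def algebra_simps)
      have "real (Suc j) * h \<le> real n * h"
        using j h0 by (intro mult_right_mono) auto
      then have st: "0 \<le> s" "s \<le> t" "t \<le> r"
        using nh h0 ts by (auto simp: s_def t_def)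
      then have sI: "s \<in> {0..r}" and tI: "t \<in> {0..r}"
        by auto
      have Tj: "T j = W (of_real h * A t) ** Z z"
        using j by (simp add: T_def coeff_h_def Let_def t_def h_def)
      define E where "E = T j - mat 1 - h *\<^sub>R F t"
      have E: "norm E \<le> h\<^sup>2 * Q"
      proof -
        have "norm E \<le> h\<^sup>2 * (exp (R * h) * R * (R + B))"
          unfolding E_def Tj F_def z_def
          using h0 l AB[OF tI] by (intro norm_step_minus_euler_le) auto
        also have "\<dots> \<le> h\<^sup>2 * Q"
          unfolding Q_def using hr R B by (intro mult_left_mono mult_right_mono) (auto intro: mult_left_mono)
        finally show ?thesis .
      qed
      \<comment> \<open>The slope is compared with the mixed value \<open>F t ** X s l\<close>:
        across the step the matrix moves by at most \<open>2 * \<omega>\<close> and the solution by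
        at most \<open>L * S * h\<close>.\<close>
      have d: "norm (X t l - X s l - h *\<^sub>R (F t ** X s l)) \<le> h * (2 * \<omega> * S + L * (L * S * h))"
      proof -
        have "norm (X t l - X s l - (t - s) *\<^sub>R (F t ** X s l))
            \<le> (t - s) * (2 * \<omega> * S + L * (L * S * h))"
        proof (rule vector_derivative_increment_bound[where f' = "\<lambda>t. F t ** X t l"])
          fix x assume x: "x \<in> {s..t}"
          then have xI: "x \<in> {0..r}" using st by auto
          have "norm (A x - A t) \<le> \<omega>"
            using x ts by (intro mod xI tI) (auto simp: h_def)
          then have 1: "norm (F x - F t) \<le> 2 * \<omega>"
            using norm_system_matrix_diff_le[of A x l t] by (simp add: F_def)
          have "norm (X x l - X s l) \<le> L * S * (x - s)"
            using x st by (intro XLip) auto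
          also have "\<dots> \<le> L * S * h"
            using x ts L0 S0 by (intro mult_left_mono) auto
          finally have 2: "norm (X x l - X s l) \<le> L * S * h" .
          have "F x ** X x l - F t ** X s l = (F x - F t) ** X x l + F t ** (X x l - X s l)"
            by (simp add: matrix_diff_rdistrib matrix_diff_ldistrib)
          also have "norm \<dots> \<le> norm (F x - F t) * norm (X x l) + norm (F t) * norm (X x l - X s l)"
            by (intro norm_triangle_le add_mono norm_matrix_mult_le)
          also have "\<dots> \<le> 2 * \<omega> * S + L * (L * S * h)"
            using om L0 by (intro add_mono mult_mono 1 2 XS F xI tI) auto
          finally show "norm (F x ** X x l - F t ** X s l) \<le> 2 * \<omega> * S + L * (L * S * h)" .
        qed (use st in \<open>auto intro!: X'\<close>)
        then show ?thesis by (simp add: ts)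
      qed
      define e where "e = P j - Y j"
      have Ys: "Y j = X s l" and Yt: "Y (Suc j) = X t l"
        by (simp_all add: Y_def s_def t_def)
      have T: "T j = mat 1 + h *\<^sub>R F t + E"
        by (simp add: E_def)
      \<comment> \<open>Adding and subtracting \<open>T j ** X s l\<close> separates the propagated
        old error from the two local errors.\<close>
      have "P (Suc j) - Y (Suc j) = (T j ** e + E ** X s l) - (X t l - X s l - h *\<^sub>R (F t ** X s l))"
      proof -
        have "T j ** X s l = X s l + h *\<^sub>R (F t ** X s l) + E ** X s l"
          by (simp add: T matrix_add_rdistrib scaleR_matrix_mult_left)
        then show ?thesis
          by (simp add: PSuc Ys Yt e_def matrix_diff_ldistrib)
      qed
      also have "norm \<dots> \<le> (norm (T j ** e) + norm (E ** X s l))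
          + norm (X t l - X s l - h *\<^sub>R (F t ** X s l))"
        by (intro norm_triangle_le_diff add_mono norm_triangle_ineq order_refl)
      also have "norm (E ** X s l) \<le> h\<^sup>2 * Q * S"
        by (rule order_trans[OF norm_matrix_mult_le]) (use Q0 in \<open>intro mult_mono E XS sI, auto\<close>)
      also have "norm (T j ** e) \<le> (1 + h * (L + Q * r)) * norm e"
      proof -
        have "T j ** e = e + h *\<^sub>R (F t ** e) + E ** e"
          by (simp add: T matrix_add_rdistrib scaleR_matrix_mult_left)
        also have "norm \<dots> \<le> norm e + h * norm (F t ** e) + norm (E ** e)"
          using h0 by (intro norm_triangle_le add_mono order_refl) simp_all
        also have "\<dots> \<le> norm e + h * (L * norm e) + (h\<^sup>2 * Q) * norm e"
          using h0 by (intro add_mono order_refl mult_left_mono order_trans[OF norm_matrix_mult_le]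
              mult_right_mono F tI E) auto
        \<comment> \<open>One factor \<open>h\<close> is traded for \<open>r\<close>, so the
          amplification is 1 plus a multiple of \<open>h\<close> and stays bounded over
          \<open>n\<close> steps.\<close>
        also have "\<dots> \<le> norm e + h * (L * norm e) + (h * r * Q) * norm e"
          using h0 hr Q0 by (intro add_mono order_refl mult_right_mono)
            (auto simp: power2_eq_square intro: mult_left_mono)
        finally show ?thesis
          by (simp add: algebra_simps)
      qed
      finally show ?thesis
        using d by (simp add: e_def \<delta>_def power2_eq_square algebra_simps)
    qed
    have \<delta>: "\<delta> \<le> h * (D * (h + \<omega>))"
    proof -
      \<comment> \<open>These are exactly the terms of \<open>D * (h + \<omega>)\<close> that do not
        occur in \<open>\<delta>\<close> divided by \<open>h\<close>.\<close>
      have "0 \<le> Q * S * \<omega> + 2 * S * h + L * L * S * \<omega>"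
        using Q0 S0 L0 om h0 by simp
      then have "Q * S * h + (2 * \<omega> * S + L * (L * S * h)) \<le> D * (h + \<omega>)"
        by (simp add: D_def algebra_simps)
      then show ?thesis
        using h0 by (simp add: \<delta>_def flip: distrib_left)
    qed
    have err: "norm (P n - X r l) \<le> G * D * (h + \<omega>)"
    proof -
      have "norm (P n - Y n) \<le> real n * (h * (D * (h + \<omega>))) * exp (real n * (h * (L + Q * r)))"
      proof (rule discrete_gronwall)
        show "norm (P 0 - Y 0) \<le> 0"
          by (simp add: P0 Y_def X0)
        show "norm (P (Suc j) - Y (Suc j))
            \<le> (1 + h * (L + Q * r)) * norm (P j - Y j) + h * (D * (h + \<omega>))" if "j < n" for j
          using step[OF that] \<delta> by linarith
      qed (use h0 L0 Q0 r D0 om in auto)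
      also have "\<dots> = (real n * h) * (D * (h + \<omega>)) * exp ((real n * h) * (L + Q * r))"
        by (simp add: mult.assoc)
      also have "\<dots> = G * D * (h + \<omega>)"
        unfolding nh G_def by (simp add: mult_ac)
      finally show ?thesis
        by (simp add: Y_def nh)
    qed
    have PS: "norm (P n) \<le> S + G * D * (h + \<omega>)"
      using err XS[of r] r norm_triangle_sub[of "P n" "X r l"] by simp
    have Zb: "norm (Z z - mat 1) \<le> exp (R * r) * (R * h)"
    proof -
      have w: "norm (\<i> * l * complex_of_real h) \<le> R * h"
        using h0 l by (simp add: norm_mult mult_right_mono)
      have "norm (Z z - mat 1) \<le> exp (norm (\<i> * l * complex_of_real h)) * norm (\<i> * l * complex_of_real h)"
        unfolding z_def by (rule order_trans[OF norm_Z_minus_1_le norm_exp_minus_1_le])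
      also have "\<dots> \<le> exp (R * r) * (R * h)"
        using w mult_left_mono[OF hr R] by (intro mult_mono) auto
      finally show ?thesis .
    qed
    \<comment> \<open>\<open>M\<close> at \<open>n\<close> has one pair more than there are steps.
      Its coefficient is the default value 0, so only \<open>Z z\<close> is left of that pair, and
      this is within order \<open>h\<close> of the identity.\<close>
    have "T n = Z z"
    proof -
      have "W 0 = mat 1"
        by (simp add: W_def mat_def vec_eq_iff forall_2)
      then show ?thesis
        by (simp add: T_def coeff_h_def)
    qed
    then have "M (coeff_h A r n) n z - X r l = (Z z - mat 1) ** P n + (P n - X r l)"
      by (simp add: MP PSuc matrix_diff_rdistrib)
    also have "norm \<dots> \<le> norm (Z z - mat 1) * norm (P n) + norm (P n - X r l)"
      by (intro norm_triangle_le add_mono norm_matrix_mult_le order_refl)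
    also have "\<dots> \<le> (exp (R * r) * (R * h)) * (S + G * D * (h + \<omega>)) + G * D * (h + \<omega>)"
      using R h0 by (intro add_mono mult_mono Zb PS err) auto
    also have "\<dots> \<le> C * (h + \<omega>)"
    proof -
      \<comment> \<open>Using \<open>h \<le> r\<close> in the second product keeps the bound linear
        in \<open>h + \<omega>\<close>.\<close>
      have "h * (S + G * D * (h + \<omega>)) = h * S + h * (G * D * (h + \<omega>))"
        by (simp add: distrib_left)
      also have "\<dots> \<le> (h + \<omega>) * S + r * (G * D * (h + \<omega>))"
        using om S0 hr G0 D0 h0 by (intro add_mono mult_right_mono) auto
      finally have "exp (R * r) * R * (h * (S + G * D * (h + \<omega>)))
          \<le> exp (R * r) * R * ((h + \<omega>) * S + r * (G * D * (h + \<omega>)))"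
        using R by (intro mult_left_mono) auto
      then show ?thesis
        by (simp add: C_def algebra_simps)
    qed
    finally show ?thesis
      by (simp add: z_def h_def)
  qed
  show thesis
    by (rule that[OF C0 bound])
qed

section \<open>Convergence, uniform on compact sets\<close>

theorem theorem9p2:
  fixes A :: "real \<Rightarrow> complex" and X :: "real \<Rightarrow> complex \<Rightarrow> complex^2^2" and r :: real
  assumes "continuous_on {0..} A"
    and "is_matrix_solution A X"
    and "r > 0"
  shows "(\<forall>l. (\<lambda>n. M (coeff_h A r n) n (exp (\<i> * l * complex_of_real (r / real n)))) \<longlonglongrightarrow> X r l) \<and>
    (\<forall>K. compact K \<longrightarrow>
      uniform_limit K (\<lambda>n l. M (coeff_h A r n) n (exp (\<i> * l * complex_of_real (r / real n))))
        (\<lambda>l. X r l) sequentially)"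
proof -
  have A: "continuous_on {0..r} A"
    using assms(1) by (rule continuous_on_subset) auto
  then have "bounded (A ` {0..r})"
    by (intro compact_imp_bounded compact_continuous_image) auto
  then obtain B where B: "0 < B" "\<And>t. t \<in> {0..r} \<Longrightarrow> norm (A t) \<le> B"
    by (auto simp: bounded_pos)
  have unif: "uniform_limit K (\<lambda>n l. M (coeff_h A r n) n (exp (\<i> * l * complex_of_real (r / real n))))
        (\<lambda>l. X r l) sequentially" if K: "compact K" for K
  proof (rule uniform_limitI)
    fix \<epsilon> :: real assume \<epsilon>: "0 < \<epsilon>"
    obtain R where R: "0 < R" "\<And>l. l \<in> K \<Longrightarrow> norm l \<le> R"
      using compact_imp_bounded[OF K] by (auto simp: bounded_pos)
    obtain C where C: "0 \<le> C" "\<And>n l \<omega>. 0 < n \<Longrightarrow> norm l \<le> R \<Longrightarrow> 0 \<le> \<omega> \<Longrightarrow>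
      (\<And>s t. s \<in> {0..r} \<Longrightarrow> t \<in> {0..r} \<Longrightarrow> \<bar>s - t\<bar> \<le> r / real n \<Longrightarrow> norm (A s - A t) \<le> \<omega>) \<Longrightarrow>
      norm (M (coeff_h A r n) n (exp (\<i> * l * complex_of_real (r / real n))) - X r l)
        \<le> C * (r / real n + \<omega>)"
      using product_error_bound[OF assms(2,3) less_imp_le[OF R(1)] less_imp_le[OF B(1)] B(2)]
      by blast
    \<comment> \<open>The final bound is \<open>C * (\<omega> + \<omega>)\<close>; dividing by
      \<open>C + 1\<close> instead of \<open>C\<close> makes it strictly less than
      \<open>\<epsilon>\<close> and covers \<open>C = 0\<close>.\<close>
    define \<omega> where "\<omega> = \<epsilon> / (C + 1) / 2"
    have \<omega>: "0 < \<omega>"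
      using \<epsilon> C(1) by (simp add: \<omega>_def)
    have sum: "C * (\<omega> + \<omega>) < \<epsilon>"
    proof -
      have "C * (\<omega> + \<omega>) = \<epsilon> * (C / (C + 1))"
        unfolding \<omega>_def field_sum_of_halves by simp
      also have "\<dots> < \<epsilon> * 1"
        using \<epsilon> C(1) by (intro mult_strict_left_mono) auto
      finally show ?thesis by simp
    qed
    have "uniformly_continuous_on {0..r} A"
      using A by (intro compact_uniformly_continuous) auto
    then obtain d where d: "0 < d"
      "\<And>s t. s \<in> {0..r} \<Longrightarrow> t \<in> {0..r} \<Longrightarrow> \<bar>s - t\<bar> < d \<Longrightarrow> norm (A s - A t) < \<omega>"
      using \<omega> unfolding uniformly_continuous_on_def dist_norm real_norm_def by metis
    have "(\<lambda>n. r / real n) \<longlonglongrightarrow> 0"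
      by (rule lim_const_over_n)
    \<comment> \<open>Being below \<open>d\<close> makes the oscillation of \<open>A\<close> over
      one step at most \<open>\<omega>\<close>; being below \<open>\<omega>\<close> absorbs the step
      size itself.\<close>
    then have "\<forall>\<^sub>F n in sequentially. r / real n < min d \<omega>"
      using d(1) \<omega> by (intro order_tendstoD) auto
    then show "\<forall>\<^sub>F n in sequentially. \<forall>l\<in>K.
        dist (M (coeff_h A r n) n (exp (\<i> * l * complex_of_real (r / real n)))) (X r l) < \<epsilon>"
      using eventually_gt_at_top[of 0]
    proof eventually_elim
      case (elim n)
      show ?case
      proof
        fix l assume l: "l \<in> K"
        have "norm (M (coeff_h A r n) n (exp (\<i> * l * complex_of_real (r / real n))) - X r l)
            \<le> C * (r / real n + \<omega>)"
          using elim \<omega> by (intro C(2) R(2) l) (auto intro!: less_imp_le[OF d(2)])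
        also have "\<dots> \<le> C * (\<omega> + \<omega>)"
          using elim C(1) by (intro mult_left_mono) auto
        also note sum
        finally show "dist (M (coeff_h A r n) n (exp (\<i> * l * complex_of_real (r / real n)))) (X r l) < \<epsilon>"
          by (simp add: dist_norm)
      qed
    qed
  qed
  \<comment> \<open>The pointwise limit is the uniform one on the compact set
    \<open>{l}\<close>.\<close>
  moreover have "(\<lambda>n. M (coeff_h A r n) n (exp (\<i> * l * complex_of_real (r / real n)))) \<longlonglongrightarrow> X r l" for l
    using tendsto_uniform_limitI[OF unif[of "{l}"]] by simp
  ultimately show ?thesis
    by blast
qed

end
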